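(* Assume the standing setup described in the context, and assume in addition that $F$ has an absolutely convergent Euler product for $\Re s>1$ in the following sense: there are complex numbers $b_n$ ($n\ge 1$), with $b_n=0$ unless $n$ is a prime power, such that $\sum_{n}b_n n^{-s}$ converges absolutely for $\Re s>1$ and $\log F(s)=\sum_{n=1}^\infty b_n n^{-s}$ there. Then there is a constant $K>0$, depending only on $m$, $k$ and the numbers $\lambda_1,\dots,\lambda_k,\mu_1,\dots,\mu_k$ (and not on $\eta$, $Q$, the $\nu_j$, or the coefficients), such that \[|F(1/2)|\le K\, C^{1/2}\exp\Big\{4\sum_{n=1}^\infty |b_n|\, n^{-3/2}\Big\}.\]
   Context: Standing setup. Let $(a_n)_{n\ge 1}$ be complex numbers such that the Dirichlet series $F(s)=\sum_{n=1}^\infty a_n n^{-s}$ converges absolutely for $\Re s>1$. Assume $F$ extends to a meromorphic function on $\mathbb{C}$ that is holomorphic everywhere except possibly for a pole at $s=1$; let $m\ge 0$ be the order of that pole ($m=0$ if there is no pole), and assume that the entire function $(s-1)^mF(s)$ has finite order. Let $k\ge 0$ be an integer, and let $\eta\in\mathbb{C}$ with $|\eta|=1$, $Q>0$, and real numbers $\lambda_j>0$, $\mu_j>0$, $\nu_j$ ($1\le j\le k$). Put $\gamma(s)=\eta Q^s\prod_{j=1}^k\Gamma(\lambda_j s+\mu_j+i\nu_j)$, where $Q^s=e^{s\log Q}$, and $\Phi(s)=\gamma(s)F(s)$. Assume the functional equation $\Phi(s)=\overline{\Phi(1-\overline{s})}$ holds identically (as meromorphic functions on $\mathbb{C}$).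 The conductor is $C=Q\prod_{j=1}^k(1+|\nu_j|)^{\lambda_j}$. *)

theory Defs
  imports "HOL-Analysis.Analysis" "HOL-Number_Theory.Prime_Powers"
begin

definition finite_order :: "(complex \<Rightarrow> complex) \<Rightarrow> bool" where
  "finite_order G \<longleftrightarrow> (\<exists>A>0. \<exists>R. \<forall>z. R \<le> norm z \<longrightarrow> norm (G z) \<le> exp (norm z powr A))"

definition gamma_factor ::
  "complex \<Rightarrow> real \<Rightarrow> nat \<Rightarrow> (nat \<Rightarrow> real) \<Rightarrow> (nat \<Rightarrow> real) \<Rightarrow> (nat \<Rightarrow> real) \<Rightarrow> complex \<Rightarrow> complex" where
  "gamma_factor eta Q k lam mu nu s =
     eta * exp (s * of_real (ln Q)) *
     (\<Prod>j<k. Gamma (of_real (lam j) * s + of_real (mu j) + \<i> * of_real (nu j)))"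

definition gamma_regular :: "nat \<Rightarrow> (nat \<Rightarrow> real) \<Rightarrow> (nat \<Rightarrow> real) \<Rightarrow> (nat \<Rightarrow> real) \<Rightarrow> complex \<Rightarrow> bool" where
  "gamma_regular k lam mu nu s \<longleftrightarrow>
     (\<forall>j<k. of_real (lam j) * s + of_real (mu j) + \<i> * of_real (nu j) \<notin> \<int>\<^sub>\<le>\<^sub>0)"

definition conductor :: "real \<Rightarrow> nat \<Rightarrow> (nat \<Rightarrow> real) \<Rightarrow> (nat \<Rightarrow> real) \<Rightarrow> real" where
  "conductor Q k lam nu = Q * (\<Prod>j<k. (1 + \<bar>nu j\<bar>) powr lam j)"

end

(*
  Write z = s - 1/2 and d = 1/2 + eps. The product F(1/2 + z) * cnj (F(1/2 - cnj z)) is holomorphic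
  in z (after removing the poles at 1/2 and -1/2) and equals |F(1/2)|^2 at z = 0. On both lines
  Re z = d and Re z = -d its modulus is |F(1/2 + d + iy)| * |F(1/2 - d + iy)|, which by the functional
  equation is |F(1/2 + d + iy)|^2 times a ratio of gamma factors. Both are dominated by explicit
  nonvanishing holomorphic functions: the gamma ratio by Q^(2d) times a product of powers
  (c_j + i nu_j + lam_j z)^(2 d lam_j) with constant real exponents, and |F(1/2 + d + iy)| by exp E(z),
  where with beta_n = b_n n^(-1/2-d)
    E(z) = sum_n (beta_n n^(-z) + cnj beta_n n^z) / (n^d + n^(-d)),
  whose real part agrees with log |F(1/2 + d + iy)| on both lines, while
  |E(0)| <= 2 sum_n |b_n| n^(-1/2-2d). Phragmen-Lindelof in the strip compares the values at z = 0,
  and then d tends to 1/2.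
*)
theory Submission
  imports Defs "HOL-Complex_Analysis.Complex_Analysis" "HOL-Real_Asymp.Real_Asymp"
begin

section \<open>Growth of Gamma along horizontal segments\<close>

lemma ln_norm_one_plus_le:
  fixes v :: complex
  assumes "1 + v \<noteq> 0"
  shows "ln (norm (1 + v)) \<le> Re v + (norm v)\<^sup>2 / 2"
proof -
  have "2 * ln (norm (1 + v)) = ln ((norm (1 + v))\<^sup>2)"
    using assms by (simp add: ln_realpow)
  also have "\<dots> \<le> (norm (1 + v))\<^sup>2 - 1"
    using assms by (intro ln_le_minus_one) simp
  also have "\<dots> = 2 * Re v + (norm v)\<^sup>2"
    unfolding cmod_power2 by (simp add: power2_eq_square algebra_simps)
  finally show ?thesis by simp
qed

text \<open>The left side telescopes into the terms \<open>ln (norm (1 + inverse (z + n)))\<close>,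
  and \<open>ln_norm_one_plus_le\<close> bounds each by a real part plus a quadratic error. Since
  \<open>norm (z + n)\<close> is at least \<open>a + n\<close>, the total error does not depend on
  \<open>Im z\<close>.\<close>

lemma ln_norm_diff_le_sum_Re_inverse:
  fixes z :: complex
  assumes a: "0 < a" "a \<le> Re z"
  shows "ln (norm (z + of_nat m)) - ln (norm z)
           \<le> (\<Sum>n<m. Re (inverse (z + of_nat n))) + (\<Sum>n<m. 1 / (a + real n)\<^sup>2) / 2"
proof (induction m)
  case (Suc m)
  define w where "w = z + of_nat m"
  have Rew: "a + real m \<le> Re w" "0 < Re w" using a by (auto simp: w_def)
  then have w0: "w \<noteq> 0" "w + 1 \<noteq> 0"
    by (auto simp: complex_eq_iff)
  then have w1: "1 + inverse w = (w + 1) / w" by (simp add: field_simps)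
  have "ln (norm (w + 1)) - ln (norm w) = ln (norm (1 + inverse w))"
    using w0 by (simp add: w1 norm_divide ln_div)
  also have "\<dots> \<le> Re (inverse w) + (norm (inverse w))\<^sup>2 / 2"
    using w0 w1 by (intro ln_norm_one_plus_le) simp
  also have "(norm (inverse w))\<^sup>2 \<le> 1 / (a + real m)\<^sup>2"
  proof -
    have "a + real m \<le> norm w" using Rew complex_Re_le_cmod[of w] by linarith
    then have "(a + real m)\<^sup>2 \<le> (norm w)\<^sup>2" using a by (intro power_mono) auto
    moreover have "(a + real m)\<^sup>2 > 0" using a by simp
    ultimately show ?thesis
      by (simp add: norm_inverse power_inverse) (simp add: inverse_eq_divide frac_le)
  qed
  finally show ?case using Suc
    by (simp add: w_def add_ac add_divide_distrib)
qed simp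

lemma summable_inverse_shifted_square:
  fixes a :: real
  assumes "0 < a"
  shows "summable (\<lambda>n. 1 / (a + real n)\<^sup>2)"
proof -
  have "summable (\<lambda>n. 1 / (real n)\<^sup>2)"
    using inverse_power_summable[of 2, where 'a = real] by (simp add: inverse_eq_divide)
  then show ?thesis
  proof (rule summable_comparison_test_ev[rotated])
    show "\<forall>\<^sub>F n in sequentially. norm (1 / (a + real n)\<^sup>2) \<le> 1 / (real n)\<^sup>2"
      using eventually_gt_at_top[of 0]
    proof eventually_elim
      case (elim n)
      then have "(real n)\<^sup>2 \<le> (a + real n)\<^sup>2" using assms by (intro power_mono) auto
      then show ?case using elim by (simp add: frac_le)
    qed
  qed
qed

text \<open>Digamma is the limit of \<open>ln m\<close> minus the partial sums of
  \<open>1 / (z + n)\<close>. The telescoped bound controls these sums by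
  \<open>ln (norm (z + m))\<close>, which is at least \<open>ln m\<close>. What matters later is
  that the additive constant depends on \<open>a\<close> only, so that the bound is uniform in
  \<open>Im z\<close>.\<close>

lemma Re_Digamma_le:
  fixes z :: complex
  assumes a: "0 < a" "a \<le> Re z"
  shows "Re (Digamma z) \<le> ln (norm z) + (\<Sum>n. 1 / (a + real n)\<^sup>2) / 2"
proof (rule tendsto_upperbound)
  have "z \<noteq> 0" using a by auto
  from tendsto_Re[OF Digamma_LIMSEQ[OF this]]
  show "(\<lambda>m. ln (real m) - (\<Sum>n<m. Re (inverse (z + of_nat n)))) \<longlonglongrightarrow> Re (Digamma z)"
    by (simp del: inverse_complex.simps)
  show "\<forall>\<^sub>F m in sequentially. ln (real m) - (\<Sum>n<m. Re (inverse (z + of_nat n)))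
           \<le> ln (norm z) + (\<Sum>n. 1 / (a + real n)\<^sup>2) / 2"
    using eventually_gt_at_top[of 0]
  proof eventually_elim
    case (elim m)
    have "real m \<le> Re (z + of_nat m)" using a by simp
    also have "\<dots> \<le> norm (z + of_nat m)" by (rule complex_Re_le_cmod)
    finally have "ln (real m) \<le> ln (norm (z + of_nat m))"
      using elim by (intro ln_mono) auto
    moreover have "(\<Sum>n<m. 1 / (a + real n)\<^sup>2) \<le> (\<Sum>n. 1 / (a + real n)\<^sup>2)"
      using a by (intro sum_le_suminf summable_inverse_shifted_square) auto
    ultimately show ?case
      using ln_norm_diff_le_sum_Re_inverse[OF a, of m] by simp
  qed
qed simp

text \<open>The mean value theorem for \<open>Re ln_Gamma\<close> on the horizontal segment from
  \<open>Complex a w\<close> to \<open>Complex b w\<close> reduces the ratio to one value of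
  \<open>Re Digamma\<close>. This replaces Stirling's formula and gives a constant that does not
  depend on the height \<open>w\<close>.\<close>

lemma norm_Gamma_ratio_le:
  fixes a0 a b w :: real
  defines "S \<equiv> (\<Sum>n. 1 / (a0 + real n)\<^sup>2) / 2"
  assumes a0: "0 < a0" "a0 \<le> a" and ab: "a < b"
  shows "norm (Gamma (Complex b w))
           \<le> norm (Gamma (Complex a w)) * (exp S * norm (Complex b w)) powr (b - a)"
proof -
  define g where "g t = Re (ln_Gamma (of_real t + \<i> * of_real w))" for t
  have deriv: "(g has_real_derivative Re (Digamma (of_real t + \<i> * of_real w))) (at t)"
    if "a \<le> t" for t
  proof -
    have "of_real t + \<i> * of_real w \<notin> (\<real>\<^sub>\<le>\<^sub>0 :: complex set)"
      using that a0 by (auto simp: complex_nonpos_Reals_iff)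
    then have "((\<lambda>z. ln_Gamma (z + \<i> * of_real w)) has_field_derivative
        Digamma (of_real t + \<i> * of_real w)) (at (of_real t :: complex))"
      by (auto intro!: derivative_eq_intros)
    then have "((\<lambda>t. ln_Gamma (of_real t + \<i> * of_real w)) has_vector_derivative
        Digamma (of_real t + \<i> * of_real w)) (at t)"
      by (rule has_vector_derivative_real_field)
    then show ?thesis
      unfolding g_def has_real_derivative_iff_has_vector_derivative
      by (rule bounded_linear.has_vector_derivative[OF bounded_linear_Re])
  qed
  obtain t where t: "a < t" "t < b"
      "g b - g a = (b - a) * Re (Digamma (of_real t + \<i> * of_real w))"
    using MVT2[OF ab deriv] by auto
  have cplx: "of_real t + \<i> * of_real w = Complex t w" for t
    by (simp add: complex_eq_iff)
  have "Re (Digamma (Complex t w)) \<le> ln (norm (Complex t w)) + S"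
    unfolding S_def using a0 t by (intro Re_Digamma_le) auto
  \<comment> \<open>The intermediate point \<open>t\<close> is unknown; the modulus increases with
    the positive real part, so the right endpoint serves as a bound.\<close>
  also have "norm (Complex t w) \<le> norm (Complex b w)"
    using a0 t by (auto simp: cmod_def intro!: power_mono)
  then have "ln (norm (Complex t w)) \<le> ln (norm (Complex b w))"
    using a0 t by (subst ln_le_cancel_iff) (auto simp: complex_eq_iff)
  finally have "g b - g a \<le> (b - a) * (ln (norm (Complex b w)) + S)"
    unfolding t(3) cplx using ab by (intro mult_left_mono) auto
  then have "exp (g b) \<le> exp (g a) * exp ((b - a) * (S + ln (norm (Complex b w))))"
    by (simp add: algebra_simps flip: exp_add)
  moreover have "norm (Gamma (Complex s w)) = exp (g s)" if "a \<le> s" for s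
  proof -
    have "Complex s w \<notin> \<int>\<^sub>\<le>\<^sub>0" using that a0 by (auto elim!: nonpos_Ints_cases simp: complex_eq_iff)
    then show ?thesis by (simp add: Gamma_complex_altdef g_def cplx)
  qed
  moreover have "exp ((b - a) * (S + ln (norm (Complex b w)))) = (exp S * norm (Complex b w)) powr (b - a)"
  proof -
    have "Complex b w \<noteq> 0" using a0 ab by (simp add: complex_eq_iff)
    then show ?thesis by (simp add: powr_def ln_mult)
  qed
  ultimately show ?thesis using ab by simp
qed

section \<open>The Phragmen-Lindelof principle in a vertical strip\<close>

text \<open>Since \<open>d < pi / 2\<close>, the real part of \<open>cos w\<close> is positive on
  the closed strip and grows like \<open>exp \<bar>Im w\<bar>\<close>. The factor
  \<open>exp (- e * cos w)\<close> therefore has modulus at most 1 and decays doubly exponentially,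
  which beats any growth of finite order. Maximum modulus on a tall rectangle is followed by letting
  \<open>e\<close> tend to 0.\<close>

lemma Phragmen_Lindelof_strip:
  fixes f :: "complex \<Rightarrow> complex"
  assumes d: "d < pi / 2"
    and hol: "f holomorphic_on {z. \<bar>Re z\<bar> < d}"
    and cont: "continuous_on {z. \<bar>Re z\<bar> \<le> d} f"
    and M: "0 < M" and A: "0 < A"
    and growth: "\<And>z. \<bar>Re z\<bar> \<le> d \<Longrightarrow> R \<le> \<bar>Im z\<bar> \<Longrightarrow> norm (f z) \<le> M * exp (B * \<bar>Im z\<bar> powr A)"
    and boundary: "\<And>z. \<bar>Re z\<bar> = d \<Longrightarrow> norm (f z) \<le> 1"
    and z: "\<bar>Re z\<bar> \<le> d"
  shows "norm (f z) \<le> 1"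
proof -
  define g where "g e w = f w * exp (- of_real e * cos w)" for e :: real and w
  have Re_cos_ge: "cos d * exp \<bar>Im w\<bar> / 2 \<le> Re (cos w)" if "\<bar>Re w\<bar> \<le> d" for w
  proof -
    have c: "cos d \<le> cos (Re w)"
      using cos_monotone_0_pi_le[of "\<bar>Re w\<bar>" d] that d by simp
    have "0 < cos d" using that d by (intro cos_gt_zero_pi) auto
    have "exp \<bar>Im w\<bar> \<le> exp (Im w) + exp (- Im w)" by (cases "Im w \<ge> 0") auto
    then have "cos d * exp \<bar>Im w\<bar> \<le> cos (Re w) * (exp (Im w) + exp (- Im w))"
      using c \<open>0 < cos d\<close> by (intro mult_mono) auto
    then show ?thesis by (simp add: Re_cos)
  qed
  have norm_g: "norm (g e w) \<le> norm (f w) * exp (- (e * cos d / 2) * exp \<bar>Im w\<bar>)"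
    if "\<bar>Re w\<bar> \<le> d" "0 < e" for e w
  proof -
    have "e * (cos d * exp \<bar>Im w\<bar> / 2) \<le> e * Re (cos w)"
      using that by (intro mult_left_mono Re_cos_ge) auto
    then show ?thesis unfolding g_def norm_mult norm_exp_eq_Re
      by (intro mult_left_mono) auto
  qed
  have cosd: "0 < cos d" using z d by (intro cos_gt_zero_pi) auto
  have g_le: "norm (g e z) \<le> 1" if e: "0 < e" for e
  proof -
    define c where "c = e * cos d / 2"
    have c: "0 < c" using e cosd by (simp add: c_def)
    have "filterlim (\<lambda>T. ln M + B * T powr A - c * exp T) at_bot at_top"
      using c A by real_asymp
    then have "\<forall>\<^sub>F T in at_top. ln M + B * T powr A - c * exp T \<le> 0"
      unfolding filterlim_at_bot by blast
    then obtain T where T: "ln M + B * T powr A - c * exp T \<le> 0" "\<bar>Im z\<bar> < T" "R < T" "0 < T"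
      using eventually_happens[OF eventually_conj[OF _ eventually_conj[OF
          eventually_gt_at_top[of "\<bar>Im z\<bar>"] eventually_conj[OF eventually_gt_at_top[of R]
          eventually_gt_at_top[of "0::real"]]]]] by force
    \<comment> \<open>The vertical sides lie on the edges of the strip, where
      \<open>boundary\<close> applies. \<open>T\<close> is so large that the damping defeats
      \<open>growth\<close> on the horizontal sides.\<close>
    define S where "S = cbox (Complex (-d) (-T)) (Complex d T)"
    show ?thesis
    proof (rule maximum_modulus_frontier[where f = "g e" and S = S])
      have "interior S \<subseteq> {z. \<bar>Re z\<bar> < d}"
        by (auto simp: S_def in_box_complex_iff)
      then show "g e holomorphic_on interior S"
        unfolding g_def by (intro holomorphic_intros holomorphic_on_subset[OF hol])
      have "closure S \<subseteq> {z. \<bar>Re z\<bar> \<le> d}"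
        by (auto simp: S_def in_cbox_complex_iff)
      then show "continuous_on (closure S) (g e)"
        unfolding g_def by (intro continuous_intros continuous_on_subset[OF cont])
      show "bounded S" by (simp add: S_def)
      show "z \<in> S" using z T by (auto simp: S_def in_cbox_complex_iff)
      fix w assume "w \<in> frontier S"
      then have w: "\<bar>Re w\<bar> \<le> d" "\<bar>Im w\<bar> \<le> T" "\<bar>Re w\<bar> = d \<or> \<bar>Im w\<bar> = T"
        by (auto simp: S_def frontier_def in_cbox_complex_iff in_box_complex_iff)
      show "norm (g e w) \<le> 1"
      proof (cases "\<bar>Re w\<bar> = d")
        case True
        have "norm (g e w) \<le> 1 * 1"
          using c by (intro order.trans[OF norm_g] mult_mono boundary)
                     (auto simp: e w True c_def)
        then show ?thesis by simp
      next
        case False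
        with w have "\<bar>Im w\<bar> = T" by simp
        then have "norm (g e w) \<le> M * exp (B * T powr A) * exp (- c * exp T)"
          using norm_g[OF w(1) e] growth[OF w(1)] T(3)
          by (intro order.trans[OF norm_g[OF w(1) e]]) (auto simp: c_def intro!: mult_right_mono)
        also have "\<dots> = exp (ln M + B * T powr A - c * exp T)"
          using M by (simp add: exp_add exp_diff exp_minus field_simps)
        also have "\<dots> \<le> 1" using T by simp
        finally show ?thesis .
      qed
    qed
  qed
  \<comment> \<open>The bound 1 is uniform in \<open>e\<close>, and \<open>g 0\<close> is
    \<open>f\<close>.\<close>
  have "((\<lambda>e. norm (g e z)) \<longlongrightarrow> norm (g 0 z)) (at_right 0)"
    unfolding g_def by (intro tendsto_intros)
  moreover have "\<forall>\<^sub>F e in at_right 0. norm (g e z) \<le> 1"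
    using g_le by (auto simp: eventually_at_filter)
  ultimately have "norm (g 0 z) \<le> 1"
    by (rule tendsto_upperbound) simp
  then show ?thesis by (simp add: g_def)
qed

section \<open>Interpolating a Dirichlet series between the two edges\<close>

text \<open>A holomorphic function is needed whose real part is the same prescribed Dirichlet series
  on both edges. Symmetrising each term under \<open>z\<close> to \<open>- cnj z\<close>, up to
  conjugation, achieves this, and the normalisation by \<open>2 * cosh (d * L n)\<close> makes the
  centre smaller than the edges by a factor of order \<open>n powr d\<close>. This gain moves the
  sum at the centre further to the right.\<close>

lemma Dirichlet_strip_interpolation:
  fixes \<beta> :: "nat \<Rightarrow> complex" and d :: real
  assumes d: "0 < d" and summ: "(\<lambda>n. norm (\<beta> n)) summable_on {1..}"
  obtains E :: "complex \<Rightarrow> complex" and M where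
    "continuous_on {z. \<bar>Re z\<bar> \<le> d} E" "E holomorphic_on {z. \<bar>Re z\<bar> < d}"
    "\<And>z. \<bar>Re z\<bar> \<le> d \<Longrightarrow> norm (E z) \<le> M"
    "\<And>z. \<bar>Re z\<bar> = d \<Longrightarrow>
       Re (E z) = Re (\<Sum>\<^sub>\<infinity>n\<in>{1..}. \<beta> n * exp (- \<i> * of_real (Im z * ln (real n))))"
    "norm (E 0) \<le> 2 * (\<Sum>\<^sub>\<infinity>n\<in>{1..}. norm (\<beta> n) / real n powr d)"
proof -
  define L where "L n = ln (real n)" for n
  have L: "0 \<le> L n" if "n \<in> {1..}" for n using that by (simp add: L_def)
  define e where "e n z = (\<beta> n * exp (- (z * of_real (L n))) + cnj (\<beta> n) * exp (z * of_real (L n)))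
                             / of_real (2 * cosh (d * L n))" for n and z :: complex
  define E where "E z = (\<Sum>\<^sub>\<infinity>n\<in>{1..}. e n z)" for z
  have cosh_pos: "0 < cosh (x :: real)" for x by simp
  have norm_e: "norm (e n z) \<le> norm (\<beta> n) * (cosh (Re z * L n) / cosh (d * L n))" for n z
  proof -
    have "norm (\<beta> n * exp (- (z * of_real (L n))) + cnj (\<beta> n) * exp (z * of_real (L n)))
            \<le> norm (\<beta> n) * (2 * cosh (Re z * L n))"
      by (rule order.trans[OF norm_triangle_ineq])
         (simp add: norm_mult cosh_def algebra_simps)
    then have "norm (e n z) \<le> norm (\<beta> n) * (2 * cosh (Re z * L n)) / (2 * cosh (d * L n))"
      unfolding e_def norm_divide using cosh_pos[of "d * L n"]
      by (intro divide_mono) (auto simp: norm_mult)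
    then show ?thesis by simp
  qed
  \<comment> \<open>As cosh is even and increasing on the nonnegative reals, the quotient of cosh
    values is at most 1 in the strip. This is the majorant for the Weierstrass M-test.\<close>
  have norm_e': "norm (e n z) \<le> norm (\<beta> n)" if "n \<in> {1..}" "z \<in> {z. \<bar>Re z\<bar> \<le> d}" for n z
  proof -
    have "cosh (Re z * L n) \<le> cosh (d * L n)"
    proof -
      have "cosh (\<bar>Re z\<bar> * L n) \<le> cosh (d * L n)"
        using that L[OF that(1)] d
        by (subst cosh_real_nonneg_le_iff) (auto intro!: mult_right_mono)
      then show ?thesis using L[OF that(1)] by (cases "Re z \<ge> 0") auto
    qed
    then have "norm (\<beta> n) * (cosh (Re z * L n) / cosh (d * L n)) \<le> norm (\<beta> n) * 1"
      using cosh_pos[of "d * L n"] by (intro mult_left_mono) auto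
    then show ?thesis using norm_e[of n z] by simp
  qed
  have ulim: "uniform_limit {z. \<bar>Re z\<bar> \<le> d} (\<lambda>X z. \<Sum>n\<in>X. e n z) E (finite_subsets_at_top {1..})"
    unfolding E_def by (rule Weierstrass_m_test_general[OF norm_e' summ])
  have e_hol: "(\<lambda>z. \<Sum>n\<in>X. e n z) holomorphic_on A" for X A
    unfolding e_def by (intro holomorphic_intros) auto
  have "continuous_on {z. \<bar>Re z\<bar> \<le> d} E"
    by (rule uniform_limit_theorem[OF _ ulim])
       (auto intro!: always_eventually holomorphic_on_imp_continuous_on e_hol)
  moreover have "E holomorphic_on {z. \<bar>Re z\<bar> < d}"
  proof -
    have op: "open {z. \<bar>Re z\<bar> < d}"
      by (intro open_Collect_less continuous_intros)
    have "\<exists>f'. (E has_field_derivative f') (at z)" if "\<bar>Re z\<bar> < d" for z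
    proof -
      have "z \<in> {z. \<bar>Re z\<bar> < d}" using that by simp
      with op obtain r where r: "0 < r" "cball z r \<subseteq> {z. \<bar>Re z\<bar> < d}"
        by (meson open_contains_cball)
      have "E holomorphic_on ball z r"
      proof (rule holomorphic_uniform_limit)
        show "uniform_limit (cball z r) (\<lambda>X z. \<Sum>n\<in>X. e n z) E (finite_subsets_at_top {1..})"
          by (intro uniform_limit_on_subset[OF ulim] order.trans[OF r(2)]) auto
        show "\<forall>\<^sub>F X in finite_subsets_at_top {1..}. continuous_on (cball z r) (\<lambda>z. \<Sum>n\<in>X. e n z)
                \<and> (\<lambda>z. \<Sum>n\<in>X. e n z) holomorphic_on ball z r"
          by (intro always_eventually allI conjI holomorphic_on_imp_continuous_on e_hol)
      qed auto
      then show ?thesis using r(1) by (auto simp: holomorphic_on_open)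
    qed
    then show ?thesis using op by (auto simp: holomorphic_on_open)
  qed
  moreover have sume: "(\<lambda>n. norm (e n z)) summable_on {1..}" if "\<bar>Re z\<bar> \<le> d" for z
    by (rule summable_on_comparison_test[OF summ]) (use norm_e' that in auto)
  have "norm (E z) \<le> (\<Sum>\<^sub>\<infinity>n\<in>{1..}. norm (\<beta> n))" if "\<bar>Re z\<bar> \<le> d" for z
    unfolding E_def
    by (rule order.trans[OF norm_infsum_bound[OF sume[OF that]]], intro infsum_mono summ sume that norm_e')
       (use that in auto)
  moreover have "Re (E z) = Re (\<Sum>\<^sub>\<infinity>n\<in>{1..}. \<beta> n * exp (- \<i> * of_real (Im z * ln (real n))))"
    if "\<bar>Re z\<bar> = d" for z
  proof -
    \<comment> \<open>With \<open>u\<close> the term on the imaginary axis, the two summands of the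
      numerator are positive multiples of \<open>u\<close> and \<open>cnj u\<close>, which have
      equal real parts. On either edge the multiples add up to the denominator.\<close>
    have Re_e: "Re (e n z) = Re (\<beta> n * exp (- \<i> * of_real (Im z * L n)))" for n
    proof -
      define u where "u = \<beta> n * exp (- \<i> * of_real (Im z * L n))"
      have polar: "exp (w * of_real (L n))
          = of_real (exp (Re w * L n)) * exp (\<i> * of_real (Im w * L n))" for w
        unfolding exp_of_real[symmetric] exp_add[symmetric]
        by (intro arg_cong[where f = exp]) (simp add: complex_eq_iff)
      have 1: "\<beta> n * exp (- (z * of_real (L n))) = of_real (exp (- Re z * L n)) * u"
        using polar[of "- z"] by (simp add: u_def)
      have 2: "cnj (\<beta> n) * exp (z * of_real (L n)) = of_real (exp (Re z * L n)) * cnj u"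
        using polar[of z] by (simp add: u_def exp_cnj)
      have "Re (e n z) = (exp (- Re z * L n) + exp (Re z * L n)) * Re u / (2 * cosh (d * L n))"
        unfolding e_def 1 2 Re_divide_of_real by (simp add: algebra_simps)
      also have "exp (- Re z * L n) + exp (Re z * L n) = 2 * cosh (d * L n)"
        using that by (cases "Re z \<ge> 0") (auto simp: cosh_def)
      finally show ?thesis using cosh_pos[of "d * L n"] by (simp add: u_def)
    qed
    have s1: "(\<lambda>n. e n z) summable_on {1..}"
      by (rule abs_summable_summable) (use sume that in auto)
    have s2: "(\<lambda>n. \<beta> n * exp (- \<i> * of_real (Im z * L n))) summable_on {1..}"
      by (rule abs_summable_summable) (use summ in \<open>simp add: norm_mult\<close>)
    show ?thesis unfolding E_def L_def[symmetric]
      by (simp only: infsum_Re[OF s1, symmetric] infsum_Re[OF s2, symmetric] Re_e)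
  qed
  moreover have "norm (E 0) \<le> 2 * (\<Sum>\<^sub>\<infinity>n\<in>{1..}. norm (\<beta> n) / real n powr d)"
  proof -
    have bd: "norm (e n 0) \<le> 2 * (norm (\<beta> n) / real n powr d)" if "n \<in> {1..}" for n
    proof -
      \<comment> \<open>The factor 2 in the bound for \<open>E 0\<close> comes from
        \<open>cosh x\<close> being at least \<open>exp x / 2\<close>.\<close>
      have "1 / cosh (d * L n) \<le> 2 / exp (d * L n)"
        using cosh_pos[of "d * L n"] by (simp add: field_simps) (simp add: cosh_def)
      also have "exp (d * L n) = real n powr d"
        using that by (simp add: powr_def L_def)
      finally have "norm (\<beta> n) * (1 / cosh (d * L n)) \<le> norm (\<beta> n) * (2 / real n powr d)"
        by (intro mult_left_mono) auto
      then show ?thesis using norm_e[of n 0] by (simp add: ac_simps)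
    qed
    have "(\<lambda>n. norm (\<beta> n) / real n powr d) summable_on {1..}"
    proof (rule summable_on_comparison_test[OF summ])
      fix n :: nat assume n: "n \<in> {1..}"
      then have "1 \<le> real n powr d" using d by (simp add: ge_one_powr_ge_zero)
      then show "norm (\<beta> n) / real n powr d \<le> norm (\<beta> n)"
        using mult_left_mono[of 1 "real n powr d" "norm (\<beta> n)"] by (simp add: divide_le_eq)
    qed auto
    then have s: "(\<lambda>n. 2 * (norm (\<beta> n) / real n powr d)) summable_on {1..}"
      by (rule summable_on_cmult_right)
    have "norm (E 0) \<le> (\<Sum>\<^sub>\<infinity>n\<in>{1..}. norm (e n 0))"
      unfolding E_def by (rule norm_infsum_bound) (use sume[of 0] d in auto)
    also have "\<dots> \<le> (\<Sum>\<^sub>\<infinity>n\<in>{1..}. 2 * (norm (\<beta> n) / real n powr d))"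
      by (intro infsum_mono s bd sume) (use d in auto)
    finally show ?thesis by (simp only: infsum_cmult_right')
  qed
  ultimately show ?thesis by (rule that)
qed

section \<open>Comparing the central value with the edges of the strip\<close>

text \<open>This is the convexity argument with the gamma factors hidden in \<open>J\<close>, which
  stands for the reciprocal of a holomorphic majorant of their ratio. The assumption
  \<open>feq\<close> is then all that is used of the functional equation. Having
  \<open>1/2 < d\<close> puts the line with real part \<open>1/2 + d\<close> into the region where
  \<open>F\<close> is the exponential of its Dirichlet series.\<close>

lemma norm_central_value_le:
  fixes F G J :: "complex \<Rightarrow> complex" and b :: "nat \<Rightarrow> complex" and d N :: real
  assumes d: "1/2 < d" "d \<le> 3/4"
    and hol: "G holomorphic_on UNIV" and ord: "finite_order G"
    and GF: "\<And>s. s \<noteq> 1 \<Longrightarrow> G s = (s - 1) ^ m * F s"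
    and J: "J holomorphic_on {z. \<bar>Re z\<bar> < 1}"
    and J_le: "\<And>z. \<bar>Re z\<bar> \<le> d \<Longrightarrow> norm (J z) \<le> N"
    and b_summable: "\<And>s. 1 < Re s \<Longrightarrow> (\<lambda>n. norm (b n / of_nat n powr s)) summable_on {1..}"
    and exp_b: "\<And>s. 1 < Re s \<Longrightarrow> exp (\<Sum>\<^sub>\<infinity>n\<in>{1..}. b n / of_nat n powr s) = F s"
    and feq: "\<And>z. \<bar>Re z\<bar> = d \<Longrightarrow>
      norm (F (Complex (1/2 - d) (Im z))) * norm (J z) \<le> norm (F (Complex (1/2 + d) (Im z)))"
  shows "(norm (F (1/2)))\<^sup>2 * norm (J 0)
           \<le> 16 ^ m * exp (4 * (\<Sum>\<^sub>\<infinity>n\<in>{1..}. norm (b n) / real n powr (3/2)))"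
proof -
  define \<beta> where "\<beta> n = b n / of_nat n powr of_real (1/2 + d)" for n :: nat
  have norm_powr: "norm (of_nat n powr of_real x :: complex) = real n powr x" for n :: nat and x
    by (simp add: norm_powr_real_powr)
  have d0: "0 < d" using d by simp
  have \<beta>_summable: "(\<lambda>n. norm (\<beta> n)) summable_on {1..}"
    unfolding \<beta>_def using d by (intro b_summable) simp
  obtain E M where E:
    "continuous_on {z. \<bar>Re z\<bar> \<le> d} E" "E holomorphic_on {z. \<bar>Re z\<bar> < d}"
    "\<And>z. \<bar>Re z\<bar> \<le> d \<Longrightarrow> norm (E z) \<le> M"
    "\<And>z. \<bar>Re z\<bar> = d \<Longrightarrow>
       Re (E z) = Re (\<Sum>\<^sub>\<infinity>n\<in>{1..}. \<beta> n * exp (- \<i> * of_real (Im z * ln (real n))))"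
    "norm (E 0) \<le> 2 * (\<Sum>\<^sub>\<infinity>n\<in>{1..}. norm (\<beta> n) / real n powr d)"
    by (rule Dirichlet_strip_interpolation[OF d0 \<beta>_summable]) (rule that)
  have norm_F: "norm (F (Complex (1/2 + d) (Im z))) = exp (Re (E z))" if "\<bar>Re z\<bar> = d" for z
  proof -
    define s where "s = Complex (1/2 + d) (Im z)"
    have "\<beta> n * exp (- \<i> * of_real (Im z * ln (real n))) = b n / of_nat n powr s"
      if "n \<in> {1..}" for n
    proof -
      have "of_nat n powr s = of_nat n powr of_real (1/2 + d) * exp (\<i> * of_real (Im z * ln (real n)))"
      proof -
        have "s = of_real (1/2 + d) + \<i> * of_real (Im z)" by (simp add: s_def complex_eq_iff)
        then show ?thesis using that by (simp add: powr_def Ln_of_nat exp_add ring_distribs mult_ac)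
      qed
      then show ?thesis by (simp add: \<beta>_def exp_minus field_simps)
    qed
    then have "(\<Sum>\<^sub>\<infinity>n\<in>{1..}. \<beta> n * exp (- \<i> * of_real (Im z * ln (real n))))
        = (\<Sum>\<^sub>\<infinity>n\<in>{1..}. b n / of_nat n powr s)"
      by (rule infsum_cong)
    then have "Re (E z) = Re (\<Sum>\<^sub>\<infinity>n\<in>{1..}. b n / of_nat n powr s)"
      using E(4)[OF that] by simp
    moreover have "F s = exp (\<Sum>\<^sub>\<infinity>n\<in>{1..}. b n / of_nat n powr s)"
      using d by (subst exp_b) (auto simp: s_def)
    ultimately show ?thesis unfolding s_def[symmetric] by simp
  qed
  have E0: "Re (E 0) \<le> 2 * (\<Sum>\<^sub>\<infinity>n\<in>{1..}. norm (b n) / real n powr (3/2))"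
  proof -
    have le: "norm (\<beta> n) / real n powr d \<le> norm (b n) / real n powr (3/2)" if "n \<in> {1..}" for n
    proof -
      \<comment> \<open>One \<open>d\<close> is already in \<open>\<beta>\<close>, the other is the
        gain at the centre; their sum with 1/2 exceeds 3/2 because \<open>d > 1/2\<close>.\<close>
      have "real n powr (3/2) \<le> real n powr ((1/2 + d) + d)"
        using that d by (intro powr_mono) auto
      then have "norm (b n) / real n powr ((1/2 + d) + d) \<le> norm (b n) / real n powr (3/2)"
        using that by (intro divide_left_mono) auto
      then show ?thesis
        unfolding \<beta>_def norm_divide norm_powr powr_add by simp
    qed
    have s: "(\<lambda>n. norm (b n) / real n powr (3/2)) summable_on {1..}"
    proof -
      have "norm (b n / of_nat n powr of_real (3/2)) = norm (b n) / real n powr (3/2)" for n :: nat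
        unfolding norm_divide norm_powr ..
      then show ?thesis using b_summable[of "of_real (3/2)"] by simp
    qed
    have "(\<Sum>\<^sub>\<infinity>n\<in>{1..}. norm (\<beta> n) / real n powr d)
        \<le> (\<Sum>\<^sub>\<infinity>n\<in>{1..}. norm (b n) / real n powr (3/2))"
      by (intro infsum_mono s le summable_on_comparison_test[OF s]) auto
    then show ?thesis using E(5) complex_Re_le_cmod[of "E 0"] by simp
  qed

  \<comment> \<open>Passing from \<open>F\<close> to \<open>G\<close> clears the pole but adds
    powers of \<open>s - 1\<close>. The denominator compensates them; its zeros at 2 and -2 lie
    outside the strip.\<close>
  define f where "f z = G (1/2 + z) * cnj (G (1/2 - cnj z)) / ((z - 2) * (z + 2)) ^ m
                          * exp (- 2 * E z) * J z" for z
  have norm_f: "norm (f z) = norm (G (1/2 + z)) * norm (G (1/2 - cnj z)) / (norm ((z - 2) * (z + 2))) ^ m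
                          * exp (- 2 * Re (E z)) * norm (J z)" for z
    by (simp add: f_def norm_mult norm_divide norm_power power_mult_distrib)
  have nz: "z - 2 \<noteq> 0" "z + 2 \<noteq> 0" if "\<bar>Re z\<bar> \<le> d" for z
    using that d by (auto simp: complex_eq_iff)
  have "(\<lambda>z. cnj (G (cnj z))) holomorphic_on UNIV"
    using holomorphic_on_compose_cnj_cnj[of G UNIV] hol by (simp add: o_def holomorphic_on_subset)
  from holomorphic_on_compose_gen[of "\<lambda>z. 1/2 - z", OF _ this]
  have hol': "(\<lambda>z. cnj (G (1/2 - cnj z))) holomorphic_on A" for A
    using holomorphic_on_diff[OF holomorphic_on_const holomorphic_on_id, of "1/2" A]
    by (simp add: o_def id_def)
  from holomorphic_on_compose_gen[of "\<lambda>z. 1/2 + z", OF _ hol]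
  have hol'': "(\<lambda>z. G (1/2 + z)) holomorphic_on A" for A
    using holomorphic_on_add[OF holomorphic_on_const holomorphic_on_id, of "1/2" A]
    by (simp add: o_def id_def)
  obtain A R where A: "0 < A" "\<And>z. R \<le> norm z \<Longrightarrow> norm (G z) \<le> exp (norm z powr A)"
    using ord unfolding finite_order_def by blast
  \<comment> \<open>For \<open>y\<close> at least 2, the number \<open>2 + y\<close> is at most
    \<open>2 * y\<close>, so finite order becomes a bound in the height alone.\<close>
  have growth: "norm (G w) \<le> exp (2 powr A * y powr A)"
    if "norm w \<le> 2 + y" "\<bar>y\<bar> \<le> norm w" "max R 2 \<le> y" for w y
  proof -
    have "norm w powr A \<le> (2 * y) powr A"
      using that A by (intro powr_mono2) auto
    then show ?thesis
      using that A(2)[of w] by (simp add: powr_mult) (meson exp_le_cancel_iff order.trans)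
  qed

  have "norm (f 0) \<le> 1"
  \<comment> \<open>\<open>B\<close> is doubled because \<open>f\<close> contains two values of
    \<open>G\<close>; \<open>M\<close> collects the bounds for \<open>exp (- 2 * E z)\<close> and
    \<open>J\<close>.\<close>
  proof (rule Phragmen_Lindelof_strip[where f = f and z = 0 and d = d and R = "max R 2"
        and M = "exp (2 * M) * (\<bar>N\<bar> + 1)" and B = "2 * 2 powr A" and A = A])
    show "d < pi / 2" using d pi_gt3 by simp
    show "f holomorphic_on {z. \<bar>Re z\<bar> < d}"
      unfolding f_def
      by (intro holomorphic_intros hol' hol'' E(2) holomorphic_on_subset[OF J]) (use d nz in auto)
    show "continuous_on {z. \<bar>Re z\<bar> \<le> d} f"
      unfolding f_def
      by (intro continuous_intros E(1) holomorphic_on_imp_continuous_on hol' hol''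
            holomorphic_on_subset[OF J]) (use d nz in auto)
    show "0 < A" "\<bar>Re 0\<bar> \<le> d" using A d by auto
    show "0 < exp (2 * M) * (\<bar>N\<bar> + 1)" by (simp add: add_nonneg_pos)
    fix z :: complex assume z: "\<bar>Re z\<bar> \<le> d" "max R 2 \<le> \<bar>Im z\<bar>"
    have "\<bar>1/2 + Re z\<bar> \<le> 2" "\<bar>1/2 - Re z\<bar> \<le> 2" using z(1) d by linarith+
    then have "norm (1/2 + z) \<le> 2 + \<bar>Im z\<bar>" "norm (1/2 - cnj z) \<le> 2 + \<bar>Im z\<bar>"
      using cmod_le[of "1/2 + z"] cmod_le[of "1/2 - cnj z"] by auto
    then have G: "norm (G (1/2 + z)) \<le> exp (2 powr A * \<bar>Im z\<bar> powr A)"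
        "norm (G (1/2 - cnj z)) \<le> exp (2 powr A * \<bar>Im z\<bar> powr A)"
      using z abs_Im_le_cmod[of "1/2 + z"] abs_Im_le_cmod[of "1/2 - cnj z"]
      by (auto intro!: growth)
    have "1 \<le> norm (z - 2)" "1 \<le> norm (z + 2)"
      using abs_Re_le_cmod[of "z - 2"] abs_Re_le_cmod[of "z + 2"] z d by auto
    then have "1 \<le> norm ((z - 2) * (z + 2))"
      using mult_mono[of 1 "norm (z - 2)" 1 "norm (z + 2)"] by (simp add: norm_mult)
    then have P: "1 \<le> norm ((z - 2) * (z + 2)) ^ m" by (rule one_le_power)
    have "exp (- 2 * Re (E z)) \<le> exp (2 * M)"
      using E(3)[OF z(1)] abs_Re_le_cmod[of "E z"] by simp
    moreover have "norm (J z) \<le> \<bar>N\<bar> + 1" using J_le[OF z(1)] by simp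
    moreover have "norm (G (1/2 + z)) * norm (G (1/2 - cnj z)) / norm ((z - 2) * (z + 2)) ^ m
        \<le> exp (2 powr A * \<bar>Im z\<bar> powr A) * exp (2 powr A * \<bar>Im z\<bar> powr A) / 1"
      using G P by (intro frac_le mult_mono) auto
    ultimately have "norm (f z) \<le> exp (2 powr A * \<bar>Im z\<bar> powr A) * exp (2 powr A * \<bar>Im z\<bar> powr A) / 1
        * exp (2 * M) * (\<bar>N\<bar> + 1)"
      unfolding norm_f by (intro mult_mono) auto
    then show "norm (f z) \<le> exp (2 * M) * (\<bar>N\<bar> + 1) * exp (2 * 2 powr A * \<bar>Im z\<bar> powr A)"
      by (simp add: mult_ac exp_double power2_eq_square)
  next
    fix z :: complex assume z: "\<bar>Re z\<bar> = d"
    define s s' where "s = Complex (1/2 + d) (Im z)" and "s' = Complex (1/2 - d) (Im z)"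
    have ss': "s \<noteq> 1" "s' \<noteq> 1" using d by (auto simp: s_def s'_def complex_eq_iff)
    have "1/2 + z = s \<and> 1/2 - cnj z = s' \<or> 1/2 + z = s' \<and> 1/2 - cnj z = s"
      using z by (auto simp: s_def s'_def complex_eq_iff)
    then have GG: "norm (G (1/2 + z)) * norm (G (1/2 - cnj z))
        = (norm (s - 1) * norm (s' - 1)) ^ m * (norm (F s) * norm (F s'))"
      using ss' by (auto simp: GF norm_mult norm_power power_mult_distrib)
    \<comment> \<open>All four numbers have the same imaginary part. On the right edge the real
      parts compare by \<open>d - 1/2 \<le> 2 - d\<close> and \<open>1/2 + d \<le> 2 + d\<close>; on
      the left edge the factors swap.\<close>
    have "norm (s - 1) * norm (s' - 1) \<le> norm (z - 2) * norm (z + 2)"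
    proof (cases "Re z \<ge> 0")
      case True
      with z d have "norm (s - 1) \<le> norm (z - 2)" "norm (s' - 1) \<le> norm (z + 2)"
        by (auto simp: s_def s'_def cmod_def abs_le_square_iff[symmetric])
      then show ?thesis by (intro mult_mono) auto
    next
      case False
      with z d have "norm (s - 1) \<le> norm (z + 2)" "norm (s' - 1) \<le> norm (z - 2)"
        by (auto simp: s_def s'_def cmod_def abs_le_square_iff[symmetric])
      then have "norm (s - 1) * norm (s' - 1) \<le> norm (z + 2) * norm (z - 2)"
        by (intro mult_mono) auto
      then show ?thesis by (simp add: mult.commute)
    qed
    then have "(norm (s - 1) * norm (s' - 1)) ^ m \<le> norm ((z - 2) * (z + 2)) ^ m"
      unfolding norm_mult by (intro power_mono) auto
    moreover have "0 < norm ((z - 2) * (z + 2)) ^ m" using nz[of z] z by simp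
    ultimately have q: "(norm (s - 1) * norm (s' - 1)) ^ m / norm ((z - 2) * (z + 2)) ^ m \<le> 1"
      by simp
    have "norm (f z) = (norm (s - 1) * norm (s' - 1)) ^ m / norm ((z - 2) * (z + 2)) ^ m
        * (norm (F s) * (norm (F s') * norm (J z)) * exp (- 2 * Re (E z)))"
      unfolding norm_f GG by simp
    also have "\<dots> \<le> 1 * (norm (F s) * norm (F s) * exp (- 2 * Re (E z)))"
      using feq[OF z] by (intro mult_mono[OF q] mult_right_mono mult_left_mono)
                         (auto simp: s_def s'_def)
    also have "\<dots> = 1"
      unfolding s_def norm_F[OF z] by (simp flip: exp_add)
    finally show "norm (f z) \<le> 1" .
  qed
  moreover have "norm (f 0) = (norm (F (1/2)))\<^sup>2 * norm (J 0) / (16 ^ m * exp (2 * Re (E 0)))"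
  proof -
    \<comment> \<open>Two such factors and the denominator \<open>4 ^ m\<close> at
      \<open>z = 0\<close> produce \<open>16 ^ m\<close>.\<close>
    have G: "norm (G (1/2)) = norm (F (1/2)) / 2 ^ m"
      by (simp add: GF norm_mult norm_power power_one_over)
    have "(16 :: real) ^ m = 2 ^ m * 2 ^ m * 4 ^ m"
      by (simp flip: power_mult_distrib)
    then show ?thesis
      by (simp add: norm_f G exp_minus field_simps power2_eq_square)
  qed
  ultimately have "(norm (F (1/2)))\<^sup>2 * norm (J 0) \<le> 16 ^ m * exp (2 * Re (E 0))"
    by simp
  also have "\<dots> \<le> 16 ^ m * exp (4 * (\<Sum>\<^sub>\<infinity>n\<in>{1..}. norm (b n) / real n powr (3/2)))"
    using E0 by simp
  finally show ?thesis .
qed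

section \<open>Gamma factors and the functional equation\<close>

lemma norm_gamma_factor_ratio_le:
  fixes lam mu nu a :: "nat \<Rightarrow> real"
  assumes eta: "norm eta = 1" and Q: "0 < Q" and d: "0 < d"
    and lam: "\<And>j. j < k \<Longrightarrow> 0 < lam j"
    and a: "\<And>j. j < k \<Longrightarrow> 0 < a j" "\<And>j. j < k \<Longrightarrow> a j \<le> lam j * (1/2 - d) + mu j"
  shows "norm (gamma_factor eta Q k lam mu nu (Complex (1/2 + d) y))
    \<le> norm (gamma_factor eta Q k lam mu nu (Complex (1/2 - d) y)) *
       (Q powr (2 * d) * (\<Prod>j<k. (exp ((\<Sum>n. 1 / (a j + real n)\<^sup>2) / 2) *
          norm (Complex (lam j * (1/2 + d) + mu j) (lam j * y + nu j))) powr (2 * d * lam j)))"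
proof -
  define S where "S j = (\<Sum>n. 1 / (a j + real n)\<^sup>2) / 2" for j
  define g where "g x j = norm (Gamma (Complex (lam j * x + mu j) (lam j * y + nu j)))" for x j
  have norm_gamma: "norm (gamma_factor eta Q k lam mu nu (Complex x y)) = Q powr x * (\<Prod>j<k. g x j)" for x
  proof -
    have "of_real (lam j) * Complex x y + of_real (mu j) + \<i> * of_real (nu j)
        = Complex (lam j * x + mu j) (lam j * y + nu j)" for j
      by (simp add: complex_eq_iff)
    then show ?thesis
      using eta Q by (simp add: gamma_factor_def g_def norm_mult powr_def flip: prod_norm)
  qed
  have "g (1/2 + d) j \<le> g (1/2 - d) j * (exp (S j) *
          norm (Complex (lam j * (1/2 + d) + mu j) (lam j * y + nu j))) powr (2 * d * lam j)"
    if "j < k" for j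
  proof -
    have eq: "(lam j * (1/2 + d) + mu j) - (lam j * (1/2 - d) + mu j) = 2 * d * lam j"
      by (simp add: algebra_simps)
    moreover have "0 < 2 * d * lam j" using d lam[OF that] by simp
    ultimately have "lam j * (1/2 - d) + mu j < lam j * (1/2 + d) + mu j" by linarith
    from norm_Gamma_ratio_le[OF a[OF that] this] show ?thesis
      unfolding g_def S_def eq .
  qed
  then have "(\<Prod>j<k. g (1/2 + d) j) \<le> (\<Prod>j<k. g (1/2 - d) j * (exp (S j) *
          norm (Complex (lam j * (1/2 + d) + mu j) (lam j * y + nu j))) powr (2 * d * lam j))"
    by (intro prod_mono) (auto simp: g_def)
  then have "Q powr (1/2 + d) * (\<Prod>j<k. g (1/2 + d) j)
      \<le> Q powr ((1/2 - d) + 2 * d) * (\<Prod>j<k. g (1/2 - d) j * (exp (S j) *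
          norm (Complex (lam j * (1/2 + d) + mu j) (lam j * y + nu j))) powr (2 * d * lam j))"
    by (intro mult_mono) (auto simp: g_def add.commute intro!: prod_nonneg)
  then show ?thesis
    unfolding norm_gamma S_def powr_add prod.distrib by (simp only: mult_ac)
qed

text \<open>Here \<open>J\<close> is made explicit. The assumption \<open>small\<close> keeps the
  Gamma arguments at real part at least \<open>mu j / 2\<close> even on the line with real part
  \<open>1/2 - d\<close>, so the constants \<open>S j\<close> can be chosen independently of
  \<open>d\<close>, as the later limit requires.\<close>

lemma norm_central_value_le_of_functional_equation:
  fixes F G :: "complex \<Rightarrow> complex" and b :: "nat \<Rightarrow> complex" and lam mu nu S :: "nat \<Rightarrow> real"
  defines "S \<equiv> \<lambda>j. (\<Sum>n. 1 / (mu j / 2 + real n)\<^sup>2) / 2"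
  assumes d: "1/2 < d" "d \<le> 3/4" and Q: "0 < Q" and eta: "norm eta = 1"
    and lam: "\<And>j. j < k \<Longrightarrow> 0 < lam j" and mu: "\<And>j. j < k \<Longrightarrow> 0 < mu j"
    and small: "\<And>j. j < k \<Longrightarrow> lam j * (d - 1/2) \<le> mu j / 2"
    and hol: "G holomorphic_on UNIV" and ord: "finite_order G"
    and GF: "\<And>s. s \<noteq> 1 \<Longrightarrow> G s = (s - 1) ^ m * F s"
    and feq: "\<And>s. s \<noteq> 0 \<Longrightarrow> s \<noteq> 1 \<Longrightarrow> gamma_regular k lam mu nu s \<Longrightarrow>
          gamma_regular k lam mu nu (1 - cnj s) \<Longrightarrow>
          gamma_factor eta Q k lam mu nu s * F s =
          cnj (gamma_factor eta Q k lam mu nu (1 - cnj s) * F (1 - cnj s))"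
    and b_summable: "\<And>s. 1 < Re s \<Longrightarrow> (\<lambda>n. norm (b n / of_nat n powr s)) summable_on {1..}"
    and exp_b: "\<And>s. 1 < Re s \<Longrightarrow> exp (\<Sum>\<^sub>\<infinity>n\<in>{1..}. b n / of_nat n powr s) = F s"
  shows "(norm (F (1/2)))\<^sup>2
    \<le> 16 ^ m * exp (4 * (\<Sum>\<^sub>\<infinity>n\<in>{1..}. norm (b n) / real n powr (3/2))) *
       ((\<Prod>j<k. (exp (S j) * (1 + 2 * lam j + mu j)) powr lam j) * conductor Q k lam nu) powr (2 * d)"
proof -
  \<comment> \<open>The shift \<open>2 * lam j\<close> serves two purposes: \<open>w j z\<close>
    stays in the right half-plane for \<open>\<bar>Re z\<bar> \<le> 1\<close>, so its complex powers
    are holomorphic, and on both edges it dominates the Gamma argument in modulus.\<close>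
  define c where "c j = 2 * lam j + mu j" for j
  define w where "w j z = of_real (c j) + \<i> * of_real (nu j) + of_real (lam j) * z" for j and z :: complex
  define P where "P z = Q powr (2 * d) * (\<Prod>j<k. (exp (S j) * norm (w j z)) powr (2 * d * lam j))" for z
  define J where "J z = of_real (Q powr - (2 * d)) *
    (\<Prod>j<k. (of_real (exp (S j)) * w j z) powr of_real (- (2 * d * lam j)))" for z
  have norm_J: "norm (J z) = inverse (P z)" for z
  proof -
    \<comment> \<open>Because the exponent is real, the modulus of the power depends only on the
      modulus of the base and not on its argument.\<close>
    have "norm ((of_real (exp (S j)) * w j z) powr of_real (- (2 * d * lam j)))
        = inverse ((exp (S j) * norm (w j z)) powr (2 * d * lam j))" for j
      by (subst norm_powr_real_powr') (simp_all only: Reals_of_real Re_complex_of_real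
            powr_minus norm_mult norm_of_real abs_exp_cancel)
    then show ?thesis
      by (simp only: J_def P_def norm_mult prod_norm[symmetric] norm_of_real powr_minus
            abs_inverse inverse_mult_distrib prod_inversef[symmetric] o_def) simp
  qed
  have Re_w: "lam j + mu j \<le> Re (w j z)" "0 < lam j + mu j" if "j < k" "\<bar>Re z\<bar> \<le> 1" for j z
  proof -
    have "lam j * (- Re z) \<le> lam j * 1" using that lam[of j] by (intro mult_left_mono) auto
    then show "lam j + mu j \<le> Re (w j z)" by (simp add: w_def c_def)
    show "0 < lam j + mu j" using that lam mu by (simp add: add_pos_pos)
  qed
  have P_pos: "0 < P z" if "\<bar>Re z\<bar> \<le> 1" for z
  proof -
    have "w j z \<noteq> 0" if "j < k" for j
      using Re_w[OF that \<open>\<bar>Re z\<bar> \<le> 1\<close>] by auto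
    then show ?thesis using Q by (auto simp: P_def intro!: mult_pos_pos prod_pos)
  qed
  \<comment> \<open>A positive lower bound for \<open>P\<close> on the strip, which makes
    \<open>J\<close> bounded there.\<close>
  define P0 where "P0 = Q powr (2 * d) * (\<Prod>j<k. (exp (S j) * (lam j + mu j)) powr (2 * d * lam j))"
  have P0_le: "P0 \<le> P z" if "\<bar>Re z\<bar> \<le> 1" for z
  proof -
    have "lam j + mu j \<le> norm (w j z)" if "j < k" for j
      using Re_w[OF that \<open>\<bar>Re z\<bar> \<le> 1\<close>] complex_Re_le_cmod[of "w j z"] by linarith
    then show ?thesis unfolding P0_def P_def
      using d lam Re_w(2)[of _ 0]
      by (intro mult_left_mono prod_mono conjI powr_mono2)
         (auto intro!: mult_nonneg_nonneg simp: less_imp_le)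
  qed
  have P0_pos: "0 < P0"
  proof -
    have "lam j + mu j \<noteq> 0" if "j < k" for j using Re_w(2)[OF that, of 0] by simp
    then show ?thesis using Q by (auto simp: P0_def intro!: mult_pos_pos prod_pos)
  qed

  have "(norm (F (1/2)))\<^sup>2 * norm (J 0)
           \<le> 16 ^ m * exp (4 * (\<Sum>\<^sub>\<infinity>n\<in>{1..}. norm (b n) / real n powr (3/2)))"
  proof (rule norm_central_value_le[OF d hol ord GF _ _ b_summable exp_b])
    have "of_real (exp (S j)) * w j z \<notin> \<real>\<^sub>\<le>\<^sub>0" if "j < k" "\<bar>Re z\<bar> < 1" for j z
    proof -
      have "0 < exp (S j) * Re (w j z)" using Re_w[of j z] that by simp
      then show ?thesis by (auto simp: complex_nonpos_Reals_iff)
    qed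
    then show "J holomorphic_on {z. \<bar>Re z\<bar> < 1}"
      unfolding J_def w_def by (intro holomorphic_intros) auto
  next
    fix z :: complex assume "\<bar>Re z\<bar> \<le> d"
    then show "norm (J z) \<le> inverse P0"
      unfolding norm_J using P0_pos P0_le[of z] d by (intro le_imp_inverse_le) auto
  next
    fix z :: complex assume z: "\<bar>Re z\<bar> = d"
    define y where "y = Im z"
    define s s' where "s = Complex (1/2 + d) y" and "s' = Complex (1/2 - d) y"
    \<comment> \<open>The reflection preserves the height, so in modulus the functional equation
      relates two points of one horizontal line.\<close>
    have s': "s' = 1 - cnj s" by (simp add: s_def s'_def complex_eq_iff)
    have a: "mu j / 2 \<le> lam j * (1/2 - d) + mu j" if "j < k" for j
      using small[OF that] by (simp add: algebra_simps)
    have pos: "0 < lam j * Re u + mu j" if "j < k" "u = s \<or> u = s'" for j u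
    proof -
      have "lam j * (1/2 - d) \<le> lam j * Re u"
        using that d lam[of j] by (intro mult_left_mono) (auto simp: s_def s'_def)
      then show ?thesis using a[OF that(1)] mu[OF that(1)] by linarith
    qed
    have reg: "of_real (lam j) * u + of_real (mu j) + \<i> * of_real (nu j) \<notin> \<int>\<^sub>\<le>\<^sub>0"
      if "j < k" "u = s \<or> u = s'" for j u
      using pos[OF that] by (auto elim!: nonpos_Ints_cases simp: complex_eq_iff)
    have "gamma_factor eta Q k lam mu nu s * F s = cnj (gamma_factor eta Q k lam mu nu s' * F s')"
      unfolding s'
      by (rule feq) (use reg d in \<open>auto simp: gamma_regular_def s'[symmetric]\<close>,
        auto simp: s_def complex_eq_iff)
    then have "norm (gamma_factor eta Q k lam mu nu s) * norm (F s)
        = norm (gamma_factor eta Q k lam mu nu s') * norm (F s')"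
      by (metis complex_mod_cnj norm_mult)
    moreover have "norm (gamma_factor eta Q k lam mu nu s)
        \<le> norm (gamma_factor eta Q k lam mu nu s') * P z"
    proof -
      have "norm (Complex (lam j * (1/2 + d) + mu j) (lam j * y + nu j)) \<le> norm (w j z)"
        if "j < k" for j
      proof -
        \<comment> \<open>The worst case is the left edge, where the claim amounts to
          \<open>1/2 + 2 * d \<le> 2\<close>, that is, to \<open>d \<le> 3/4\<close>.\<close>
        have "lam j * (1/2 + d) + mu j \<le> c j + lam j * Re z"
        proof -
          have "lam j * (1/2 + d - Re z) \<le> lam j * 2"
            using lam[OF that] z d by (intro mult_left_mono) auto
          then show ?thesis by (simp add: c_def algebra_simps)
        qed
        moreover have "0 \<le> lam j * (1/2 + d) + mu j"
          using lam[OF that] mu[OF that] d by simp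
        ultimately have "(lam j * (1/2 + d) + mu j)\<^sup>2 \<le> (c j + lam j * Re z)\<^sup>2"
          by (rule power_mono)
        then show ?thesis by (simp add: cmod_def w_def y_def add_ac)
      qed
      then have "Q powr (2 * d) * (\<Prod>j<k. (exp (S j) *
          norm (Complex (lam j * (1/2 + d) + mu j) (lam j * y + nu j))) powr (2 * d * lam j)) \<le> P z"
        unfolding P_def using lam d
        by (intro mult_left_mono prod_mono conjI powr_mono2) (auto simp: less_imp_le)
      then have "norm (gamma_factor eta Q k lam mu nu s') * (Q powr (2 * d) * (\<Prod>j<k. (exp (S j) *
          norm (Complex (lam j * (1/2 + d) + mu j) (lam j * y + nu j))) powr (2 * d * lam j)))
        \<le> norm (gamma_factor eta Q k lam mu nu s') * P z"
        by (intro mult_left_mono) auto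
      moreover have "norm (gamma_factor eta Q k lam mu nu s)
        \<le> norm (gamma_factor eta Q k lam mu nu s') * (Q powr (2 * d) * (\<Prod>j<k. (exp (S j) *
          norm (Complex (lam j * (1/2 + d) + mu j) (lam j * y + nu j))) powr (2 * d * lam j)))"
        unfolding s_def s'_def S_def
        by (rule norm_gamma_factor_ratio_le) (use eta Q d lam mu a in auto)
      ultimately show ?thesis by (rule order.trans[rotated])
    qed
    ultimately have "norm (gamma_factor eta Q k lam mu nu s') * norm (F s')
        \<le> norm (gamma_factor eta Q k lam mu nu s') * P z * norm (F s)"
      using mult_right_mono[of _ _ "norm (F s)"] by (metis norm_ge_zero)
    \<comment> \<open>Gamma has no zeros, but its default value at a pole is 0; \<open>reg\<close>
      rules the poles out, so the factor can be cancelled.\<close>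
    moreover have "gamma_factor eta Q k lam mu nu s' \<noteq> 0"
      using eta reg by (auto simp: gamma_factor_def Gamma_eq_zero_iff)
    ultimately have "norm (F s') \<le> P z * norm (F s)"
      by (simp add: mult.assoc)
    then show "norm (F (Complex (1/2 - d) (Im z))) * norm (J z) \<le> norm (F (Complex (1/2 + d) (Im z)))"
      using P_pos[of z] z d by (simp add: norm_J s_def s'_def y_def field_simps)
  qed
  then have "(norm (F (1/2)))\<^sup>2
      \<le> 16 ^ m * exp (4 * (\<Sum>\<^sub>\<infinity>n\<in>{1..}. norm (b n) / real n powr (3/2))) * P 0"
    using P_pos[of 0] by (simp add: norm_J field_simps)
  also have "\<dots> \<le> 16 ^ m * exp (4 * (\<Sum>\<^sub>\<infinity>n\<in>{1..}. norm (b n) / real n powr (3/2))) *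
      ((\<Prod>j<k. (exp (S j) * (1 + 2 * lam j + mu j)) powr lam j) * conductor Q k lam nu) powr (2 * d)"
  proof (rule mult_left_mono)
    \<comment> \<open>This splits off the only dependence on \<open>nu\<close>, in the shape that
      occurs in the conductor.\<close>
    have "norm (w j 0) \<le> (1 + c j) * (1 + \<bar>nu j\<bar>)" if "j < k" for j
    proof -
      have c: "0 \<le> c j" using lam[OF that] mu[OF that] by (simp add: c_def)
      have "norm (w j 0) \<le> c j + \<bar>nu j\<bar>"
        using norm_triangle_ineq[of "of_real (c j) :: complex" "\<i> * of_real (nu j)"] c
        by (simp add: w_def norm_mult)
      also have "\<dots> \<le> (1 + c j) * (1 + \<bar>nu j\<bar>)" using c by (simp add: algebra_simps)
      finally show ?thesis .
    qed
    then have "P 0 \<le> Q powr (2 * d) *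
        (\<Prod>j<k. (exp (S j) * ((1 + c j) * (1 + \<bar>nu j\<bar>))) powr (2 * d * lam j))"
      unfolding P_def using lam d
      by (intro mult_left_mono prod_mono conjI powr_mono2) (auto simp: less_imp_le)
    also have "(\<Prod>j<k. (exp (S j) * ((1 + c j) * (1 + \<bar>nu j\<bar>))) powr (2 * d * lam j))
        = (\<Prod>j<k. (exp (S j) * (1 + c j)) powr lam j * (1 + \<bar>nu j\<bar>) powr lam j) powr (2 * d)"
    proof -
      have "(exp (S j) * ((1 + c j) * (1 + \<bar>nu j\<bar>))) powr (2 * d * lam j)
          = ((exp (S j) * (1 + c j)) powr lam j * (1 + \<bar>nu j\<bar>) powr lam j) powr (2 * d)"
        if "j < k" for j
      proof -
        have "0 \<le> 1 + c j" using lam[OF that] mu[OF that] by (simp add: c_def)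
        then show ?thesis by (simp add: powr_mult powr_powr mult_ac)
      qed
      then show ?thesis by (subst prod_powr_distrib) auto
    qed
    also have "Q powr (2 * d) * \<dots> = ((\<Prod>j<k. (exp (S j) * (1 + c j)) powr lam j) *
        conductor Q k lam nu) powr (2 * d)"
      using Q by (simp add: conductor_def prod.distrib prod_nonneg powr_mult mult_ac)
    finally show "P 0 \<le> ((\<Prod>j<k. (exp (S j) * (1 + 2 * lam j + mu j)) powr lam j) *
        conductor Q k lam nu) powr (2 * d)"
      by (simp add: c_def add.assoc)
  qed simp
  finally show ?thesis .
qed

section \<open>The limit \<open>d\<close> to 1/2 and the uniform constant\<close>

theorem mainTheorem1:
  fixes m k :: nat and lam mu :: "nat \<Rightarrow> real"
  assumes "\<forall>j<k. lam j > 0" and "\<forall>j<k. mu j > 0"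
  shows "\<exists>K>0. \<forall>(a :: nat \<Rightarrow> complex) (b :: nat \<Rightarrow> complex) (F :: complex \<Rightarrow> complex)
            (eta :: complex) (Q :: real) (nu :: nat \<Rightarrow> real).
     (\<forall>s. 1 < Re s \<longrightarrow>
          (\<lambda>n. norm (a n / of_nat n powr s)) summable_on {1..} \<and>
          ((\<lambda>n. a n / of_nat n powr s) has_sum F s) {1..}) \<and>
     F holomorphic_on (- {1}) \<and>
     (\<exists>G. G holomorphic_on UNIV \<and> finite_order G \<and>
          (\<forall>s. s \<noteq> 1 \<longrightarrow> G s = (s - 1) ^ m * F s) \<and>
          (0 < m \<longrightarrow> G 1 \<noteq> 0)) \<and>
     norm eta = 1 \<and> 0 < Q \<and>
     (\<forall>s. s \<noteq> 0 \<and> s \<noteq> 1 \<and> gamma_regular k lam mu nu s \<and>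
          gamma_regular k lam mu nu (1 - cnj s) \<longrightarrow>
          gamma_factor eta Q k lam mu nu s * F s =
          cnj (gamma_factor eta Q k lam mu nu (1 - cnj s) * F (1 - cnj s))) \<and>
     (\<forall>n. \<not> primepow n \<longrightarrow> b n = 0) \<and>
     (\<forall>s. 1 < Re s \<longrightarrow>
          (\<lambda>n. norm (b n / of_nat n powr s)) summable_on {1..} \<and>
          exp (infsum (\<lambda>n. b n / of_nat n powr s) {1..}) = F s)
     \<longrightarrow> norm (F (1/2)) \<le>
          K * sqrt (conductor Q k lam nu) *
          exp (4 * infsum (\<lambda>n. norm (b n) / real n powr (3/2)) {1..})"
proof -
  \<comment> \<open>\<open>X\<close> is built from \<open>k\<close>, \<open>lam\<close> and
    \<open>mu\<close> alone, which gives the required uniformity of the witness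
    \<open>4 ^ m * sqrt X\<close>.\<close>
  define X where "X = (\<Prod>j<k. (exp ((\<Sum>n. 1 / (mu j / 2 + real n)\<^sup>2) / 2) *
    (1 + 2 * lam j + mu j)) powr lam j)"
  have X_pos: "0 < X"
  proof -
    have "1 + 2 * lam j + mu j \<noteq> 0" if "j < k" for j
      using assms that by (metis add_pos_pos less_irrefl zero_less_numeral zero_less_one mult_pos_pos)
    then show ?thesis by (auto simp: X_def intro!: prod_pos)
  qed
  show ?thesis
  proof (intro exI[of _ "4 ^ m * sqrt X"] conjI allI impI; (elim conjE exE)?)
    show "0 < 4 ^ m * sqrt X" using X_pos by simp
  next
    fix a b :: "nat \<Rightarrow> complex" and F G :: "complex \<Rightarrow> complex" and eta :: complex
      and Q :: real and nu :: "nat \<Rightarrow> real"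
    define B where "B = (\<Sum>\<^sub>\<infinity>n\<in>{1..}. norm (b n) / real n powr (3/2))"
    define C where "C = conductor Q k lam nu"
    assume G: "G holomorphic_on UNIV" "finite_order G"
        "\<forall>s. s \<noteq> 1 \<longrightarrow> G s = (s - 1) ^ m * F s"
      and eta: "norm eta = 1" and Q: "0 < Q"
      and feq: "\<forall>s. s \<noteq> 0 \<and> s \<noteq> 1 \<and> gamma_regular k lam mu nu s \<and>
          gamma_regular k lam mu nu (1 - cnj s) \<longrightarrow>
          gamma_factor eta Q k lam mu nu s * F s =
          cnj (gamma_factor eta Q k lam mu nu (1 - cnj s) * F (1 - cnj s))"
      and b: "\<forall>s. 1 < Re s \<longrightarrow>
          (\<lambda>n. norm (b n / of_nat n powr s)) summable_on {1..} \<and>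
          exp (infsum (\<lambda>n. b n / of_nat n powr s) {1..}) = F s"
    have "0 < 1 + \<bar>nu j\<bar>" for j by simp
    then have C_pos: "0 < C"
      using Q by (auto simp: C_def conductor_def intro!: mult_pos_pos prod_pos)
    \<comment> \<open>How close \<open>d\<close> must be to 1/2 depends on \<open>j\<close>; with
      finitely many indices one neighbourhood works for all.\<close>
    have "\<forall>\<^sub>F d in at_right (1/2). lam j * (d - 1/2) < mu j / 2" if "j \<in> {..<k}" for j
    proof (rule order_tendstoD(2))
      show "((\<lambda>d. lam j * (d - 1/2)) \<longlongrightarrow> lam j * (1/2 - 1/2)) (at_right (1/2))"
        by (intro tendsto_intros)
      show "lam j * (1/2 - 1/2) < mu j / 2" using assms that by simp
    qed
    then have "\<forall>\<^sub>F d in at_right (1/2). \<forall>j\<in>{..<k}. lam j * (d - 1/2) < mu j / 2"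
      by (intro eventually_ball_finite ballI) auto
    then have "\<forall>\<^sub>F d in at_right (1/2). (norm (F (1/2)))\<^sup>2 \<le> 16 ^ m * exp (4 * B) * (X * C) powr (2 * d)"
      using eventually_at_right_less[of "1/2 :: real"]
        eventually_at_right_real[of "1/2" "3/4 :: real", simplified]
    proof eventually_elim
      case (elim d)
      show ?case unfolding B_def C_def X_def
        by (rule norm_central_value_le_of_functional_equation[where eta = eta and G = G])
           (use elim Q eta G feq b assms in \<open>auto simp: less_imp_le\<close>)
    qed
    \<comment> \<open>Only the exponent varies with \<open>d\<close>, and in the limit the conductor
      appears to the first power in a bound for the square of the central value.\<close>
    moreover have "((\<lambda>d. 16 ^ m * exp (4 * B) * (X * C) powr (2 * d)) \<longlongrightarrow>
        16 ^ m * exp (4 * B) * (X * C) powr (2 * (1/2))) (at_right (1/2))"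
      using X_pos C_pos by (intro tendsto_intros) auto
    ultimately have "(norm (F (1/2)))\<^sup>2 \<le> 16 ^ m * exp (4 * B) * (X * C) powr (2 * (1/2))"
      by (intro tendsto_lowerbound[rotated]) auto
    also have "\<dots> = (4 ^ m * sqrt X * sqrt C * exp (2 * B))\<^sup>2"
    proof -
      have "(16 :: real) ^ m = (4 ^ m)\<^sup>2"
        by (simp add: power2_eq_square flip: power_mult_distrib)
      moreover have "exp (4 * B) = (exp (2 * B))\<^sup>2" by (simp flip: exp_double)
      ultimately show ?thesis using X_pos C_pos by (simp add: power_mult_distrib mult_ac)
    qed
    finally have "norm (F (1/2)) \<le> 4 ^ m * sqrt X * sqrt C * exp (2 * B)"
      by (rule power2_le_imp_le) (use X_pos C_pos in auto)
    \<comment> \<open>The square root halves the exponent to \<open>2 * B\<close>, so the claimed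
      \<open>4 * B\<close> is reached with room to spare.\<close>
    also have "\<dots> \<le> 4 ^ m * sqrt X * sqrt C * exp (4 * B)"
    proof -
      have "0 \<le> B" by (auto simp: B_def intro!: infsum_nonneg)
      then show ?thesis using X_pos C_pos by (intro mult_left_mono) auto
    qed
    finally show "norm (F (1/2)) \<le> 4 ^ m * sqrt X * sqrt (conductor Q k lam nu) *
        exp (4 * (\<Sum>\<^sub>\<infinity>n\<in>{1..}. norm (b n) / real n powr (3/2)))"
      unfolding B_def C_def .
  qed
qed

end
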